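(* Suppose that $A$ and $S$ are lattices in $\mathbb{R}^k$ and $\mathbb{R}^n$, respectively, and that $r$, $p$ and $\Gamma$ are supermodular. Then the value function $V$ is supermodular.
   Context: Discounted dynamic programming model (infinite horizon). $S\subseteq\mathbb{R}^n$ (states, a separable complete metric space) and $A\subseteq\mathbb{R}^k$ (actions) are measurable (measurable means Borel). $\Gamma:S\to2^A$ gives the feasible actions. $p(s,a,\cdot)$ is a probability measure on $S$ for each $(s,a)\in S\times A$, with $p(\cdot,\cdot,B)$ measurable for each Borel $B$. $r:S\times A\to\mathbb{R}$ is the measurable payoff and $\beta\in(0,1)$ the discount factor. Strategies: $\sigma=(\sigma_t)_{t\ge1}$ with $\sigma_t:S\times(A\times S)^{t-1}\to A$ Borel measurable and $\sigma_t(s(1),a(1),\dots,s(t))\in\Gamma(s(t))$. With initial state $s(1)=s$, $V_\sigma(s)=\mathbb{E}_\sigma\sum_{t=1}^\infty\beta^{t-1}r(s(t),a(t))$, where $\mathbb{E}_\sigma$ is the expectation for the process generated by $\sigma$ and $p$; the value function is $V(s)=\sup_\sigma V_\sigma(s)$. Standing assumptions: $r$ is bounded and u.s.c. (upper semi-continuous); $p$ is u.s.c., i.e., $(s,a)\mapsto\int f(s')p(s,a,ds')$ is u.s.c. and bounded whenever $f:S\to\mathbb{R}$ is u.s.c. and bounded; $\Gamma$ is u.s.c., i.e., $\{s:\Gamma(s)\subseteq U\}$ is open whenever $U\subseteq A$ is open; $\Gamma(s)$ is nonempty and compact for each $s$. (Under these, $V$ is the unique bounded u.s.c. solution of $V(s)=\max_{a\in\Gamma(s)}[r(s,a)+\beta\int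 V(s')p(s,a,ds')]$.) Definitions: a lattice in $\mathbb{R}^m$ is a subset closed under componentwise maximum $x\lor y$ and componentwise minimum $x\land y$ (product order). $f:X\to\mathbb{R}$ on a lattice $X$ is supermodular if $f(x)+f(x')\le f(x\lor x')+f(x\land x')$ for all $x,x'\in X$. "$r$ is supermodular" means on the lattice $S\times A$. $p$ is supermodular if $g(s,a)=\int f(s')p(s,a,ds')$ is supermodular on $S\times A$ whenever $f:S\to\mathbb{R}$ is supermodular (measurable, integrals defined). $\Gamma$ is supermodular if $a'\in\Gamma(s')$ and $a''\in\Gamma(s'')$ imply $a'\lor a''\in\Gamma(s'\lor s'')$ and $a'\land a''\in\Gamma(s'\land s'')$ for all $s',s''\in S$. *)

theory Defs
  imports "HOL-Probability.Probability"
begin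

abbreviation borel_on :: "'x::topological_space set \<Rightarrow> 'x measure" where
  "borel_on X \<equiv> restrict_space borel X"

text \<open>Real functions on \<open>X\<close> are total functions considered only on \<open>X\<close>; topological notions
  on \<open>X\<close> refer to the subspace topology.\<close>

definition usc_on :: "'x::topological_space set \<Rightarrow> ('x \<Rightarrow> real) \<Rightarrow> bool" where
  "usc_on X f \<longleftrightarrow> (\<forall>c. openin (top_of_set X) {x \<in> X. f x < c})"

definition usc_kernel :: "'s::topological_space set \<Rightarrow> 'a::topological_space set \<Rightarrow>
    ('s \<times> 'a \<Rightarrow> 's measure) \<Rightarrow> bool" where
  "usc_kernel S A p \<longleftrightarrow>
     (\<forall>f. usc_on S f \<and> bounded (f ` S) \<longrightarrow>
        usc_on (S \<times> A) (\<lambda>x. \<integral>s'. f s' \<partial>p x) \<and>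
        bounded ((\<lambda>x. \<integral>s'. f s' \<partial>p x) ` (S \<times> A)))"

definition usc_correspondence :: "'s::topological_space set \<Rightarrow> 'a::topological_space set \<Rightarrow>
    ('s \<Rightarrow> 'a set) \<Rightarrow> bool" where
  "usc_correspondence S A \<Gamma> \<longleftrightarrow>
     (\<forall>U. openin (top_of_set A) U \<longrightarrow> openin (top_of_set S) {s \<in> S. \<Gamma> s \<subseteq> U})"

text \<open>On \<^typ>\<open>real ^ 'n\<close> and on products, \<^const>\<open>sup\<close> and \<^const>\<open>inf\<close> are componentwise.\<close>

definition is_lattice :: "'x::lattice set \<Rightarrow> bool" where
  "is_lattice X \<longleftrightarrow> (\<forall>x\<in>X. \<forall>y\<in>X. sup x y \<in> X \<and> inf x y \<in> X)"

definition supermodular_on :: "'x::lattice set \<Rightarrow> ('x \<Rightarrow> real) \<Rightarrow> bool" where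
  "supermodular_on X f \<longleftrightarrow> (\<forall>x\<in>X. \<forall>x'\<in>X. f x + f x' \<le> f (sup x x') + f (inf x x'))"

definition supermodular_kernel :: "'s::{topological_space,lattice} set \<Rightarrow> 'a::lattice set \<Rightarrow>
    ('s \<times> 'a \<Rightarrow> 's measure) \<Rightarrow> bool" where
  "supermodular_kernel S A p \<longleftrightarrow>
     (\<forall>f. supermodular_on S f \<and> f \<in> borel_measurable (borel_on S) \<and>
          (\<forall>x\<in>S \<times> A. integrable (p x) f) \<longrightarrow>
        supermodular_on (S \<times> A) (\<lambda>x. \<integral>s'. f s' \<partial>p x))"

definition supermodular_correspondence :: "'s::lattice set \<Rightarrow> ('s \<Rightarrow> 'a::lattice set) \<Rightarrow> bool" where
  "supermodular_correspondence S \<Gamma> \<longleftrightarrow>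
     (\<forall>s'\<in>S. \<forall>s''\<in>S. \<forall>a'\<in>\<Gamma> s'. \<forall>a''\<in>\<Gamma> s''.
        sup a' a'' \<in> \<Gamma> (sup s' s'') \<and> inf a' a'' \<in> \<Gamma> (inf s' s''))"

text \<open>Time starts at 0. A play is a sequence \<open>\<omega>\<close> of state-action pairs, and the history
  \<open>(s(0), a(0), \<dots>, s(t-1), a(t-1), s(t))\<close> on which the action at time \<open>t\<close> depends is the pair
  of \<open>\<omega>\<close> restricted to \<open>{0..<t}\<close> and the current state \<open>s(t)\<close>.\<close>

type_synonym ('s, 'a) strategy = "nat \<Rightarrow> (nat \<Rightarrow> 's \<times> 'a) \<times> 's \<Rightarrow> 'a"

abbreviation histories :: "'s::topological_space set \<Rightarrow> 'a::topological_space set \<Rightarrow> nat \<Rightarrow>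
    ((nat \<Rightarrow> 's \<times> 'a) \<times> 's) measure" where
  "histories S A t \<equiv> PiM {0..<t} (\<lambda>_. borel_on (S \<times> A)) \<Otimes>\<^sub>M borel_on S"

definition strategies :: "'s::topological_space set \<Rightarrow> 'a::topological_space set \<Rightarrow>
    ('s \<Rightarrow> 'a set) \<Rightarrow> ('s, 'a) strategy set" where
  "strategies S A \<Gamma> =
     {\<sigma>. \<forall>t. \<sigma> t \<in> histories S A t \<rightarrow>\<^sub>M borel_on A \<and>
           (\<forall>(h, s)\<in>space (histories S A t). \<sigma> t (h, s) \<in> \<Gamma> s)}"

fun state_law :: "'s::topological_space set \<Rightarrow> ('s \<times> 'a \<Rightarrow> 's measure) \<Rightarrow> 's \<Rightarrow> nat \<Rightarrow>
    (nat \<Rightarrow> 's \<times> 'a) \<Rightarrow> 's measure" where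
  "state_law S p s 0 h = return (borel_on S) s"
| "state_law S p s (Suc t) h = p (h t)"

definition step_law :: "'s::topological_space set \<Rightarrow> 'a::topological_space set \<Rightarrow>
    ('s \<times> 'a \<Rightarrow> 's measure) \<Rightarrow> ('s, 'a) strategy \<Rightarrow> 's \<Rightarrow> nat \<Rightarrow>
    (nat \<Rightarrow> 's \<times> 'a) \<Rightarrow> ('s \<times> 'a) measure" where
  "step_law S A p \<sigma> s t h =
     distr (state_law S p s t h) (borel_on (S \<times> A)) (\<lambda>x. (x, \<sigma> t (h, x)))"

text \<open>The law of the play generated by \<open>\<sigma>\<close> and \<open>p\<close> from the initial state \<open>s\<close>: the measure
  that the Ionescu-Tulcea theorem yields for the kernels \<^const>\<open>step_law\<close>.\<close>

definition play_law :: "'s::topological_space set \<Rightarrow> 'a::topological_space set \<Rightarrow>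
    ('s \<times> 'a \<Rightarrow> 's measure) \<Rightarrow> ('s, 'a) strategy \<Rightarrow> 's \<Rightarrow> (nat \<Rightarrow> 's \<times> 'a) measure" where
  "play_law S A p \<sigma> s =
     projective_family.lim UNIV
       (Ionescu_Tulcea.CI (step_law S A p \<sigma> s) (\<lambda>_. borel_on (S \<times> A)))
       (\<lambda>_. borel_on (S \<times> A))"

definition strategy_value :: "'s::topological_space set \<Rightarrow> 'a::topological_space set \<Rightarrow>
    ('s \<times> 'a \<Rightarrow> 's measure) \<Rightarrow> ('s \<times> 'a \<Rightarrow> real) \<Rightarrow> real \<Rightarrow> ('s, 'a) strategy \<Rightarrow> 's \<Rightarrow> real" where
  "strategy_value S A p r \<beta> \<sigma> s =
     (\<integral>\<omega>. (\<Sum>t. \<beta> ^ t * r (\<omega> t)) \<partial>play_law S A p \<sigma> s)"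

definition value_function :: "'s::topological_space set \<Rightarrow> 'a::topological_space set \<Rightarrow>
    ('s \<Rightarrow> 'a set) \<Rightarrow> ('s \<times> 'a \<Rightarrow> 's measure) \<Rightarrow> ('s \<times> 'a \<Rightarrow> real) \<Rightarrow> real \<Rightarrow> 's \<Rightarrow> real" where
  "value_function S A \<Gamma> p r \<beta> s = (SUP \<sigma>\<in>strategies S A \<Gamma>. strategy_value S A p r \<beta> \<sigma> s)"

end

theory Submission
  imports Defs
begin

text \<open>The finite-horizon values \<open>v n\<close>, obtained from 0 by iterating the optimality operator, are
  bounded, u.s.c. and supermodular. Supermodularity is inherited because for optimal actions
  \<open>a \<in> \<Gamma> s\<close>, \<open>a' \<in> \<Gamma> s'\<close> the actions \<open>sup a a'\<close> and \<open>inf a a'\<close> are feasible at \<open>sup s s'\<close> and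
  \<open>inf s s'\<close>. No strategy earns more than \<open>v n s\<close> in the first \<open>n\<close> periods, and measurably selected
  maximisers attain it; the payoffs after time \<open>n\<close> contribute at most \<open>\<beta> ^ n * K / (1 - \<beta>)\<close> in
  absolute value. Hence \<open>v n\<close> converges pointwise to the value function, and supermodularity passes
  to the limit.\<close>

section \<open>Upper semicontinuity and measurable selection\<close>

lemma usc_on_add:
  assumes "usc_on X f" "usc_on X g"
  shows "usc_on X (\<lambda>x. f x + g x)"
  unfolding usc_on_def
proof
  fix c
  \<comment> \<open>Any real \<open>q\<close> strictly between \<open>f x\<close> and
    \<open>c - g x\<close> witnesses membership in the union.\<close>
  have "{x \<in> X. f x + g x < c} = (\<Union>q. {x \<in> X. f x < q} \<inter> {x \<in> X. g x < c - q})"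
  proof (intro equalityI subsetI)
    fix x assume x: "x \<in> {x \<in> X. f x + g x < c}"
    then obtain q where "f x < q" "q < c - g x"
      using dense[of "f x" "c - g x"] by auto
    with x show "x \<in> (\<Union>q. {x \<in> X. f x < q} \<inter> {x \<in> X. g x < c - q})"
      by (auto intro!: exI[of _ q])
  qed auto
  also have "openin (top_of_set X) \<dots>"
    using assms by (intro openin_Union) (auto simp: usc_on_def intro!: openin_Int)
  finally show "openin (top_of_set X) {x \<in> X. f x + g x < c}" .
qed

lemma usc_on_cmult:
  assumes "usc_on X f" "0 < (c::real)"
  shows "usc_on X (\<lambda>x. c * f x)"
proof -
  have "{x \<in> X. c * f x < d} = {x \<in> X. f x < d / c}" for d
    using assms by (auto simp: field_simps)
  then show ?thesis
    using assms by (simp add: usc_on_def)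
qed

lemma usc_on_compose:
  assumes "usc_on Y f" "continuous_on X h" "h ` X \<subseteq> Y"
  shows "usc_on X (\<lambda>x. f (h x))"
  unfolding usc_on_def
proof
  fix c
  have "openin (top_of_set X) (X \<inter> h -` {y \<in> Y. f y < c})"
    using assms by (intro continuous_openin_preimage[of X h Y]) (auto simp: usc_on_def)
  also have "X \<inter> h -` {y \<in> Y. f y < c} = {x \<in> X. f (h x) < c}"
    using assms(3) by auto
  finally show "openin (top_of_set X) {x \<in> X. f (h x) < c}" .
qed

lemma openin_sets_borel_on: "openin (top_of_set X) U \<Longrightarrow> U \<in> sets (borel_on X)"
  unfolding openin_open sets_restrict_space by (metis borel_open imageI)

lemma closedin_sets_borel_on: "closedin (top_of_set X) C \<Longrightarrow> C \<in> sets (borel_on X)"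
  unfolding closedin_closed sets_restrict_space by (metis borel_closed imageI)

lemma usc_on_closedin_ge:
  assumes "usc_on X f"
  shows "closedin (top_of_set X) {x \<in> X. c \<le> f x}"
proof -
  have "{x \<in> X. c \<le> f x} = X - {x \<in> X. f x < c}" by auto
  then show ?thesis
    using assms by (auto simp: usc_on_def closedin_def double_diff Diff_Diff_Int Int_absorb1)
qed

lemma borel_measurable_usc_on:
  assumes "usc_on X f"
  shows "f \<in> borel_measurable (borel_on X)"
  unfolding borel_measurable_iff_less
proof
  fix c
  have "{x \<in> space (borel_on X). f x < c} = {x \<in> X. f x < c}"
    by (auto simp: space_restrict_space)
  then show "{x \<in> space (borel_on X). f x < c} \<in> sets (borel_on X)"
    using assms openin_sets_borel_on[of X "{x \<in> X. f x < c}"] by (simp add: usc_on_def)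
qed

text \<open>If no maximum were attained, the relatively open sets \<open>U b\<close> would cover
  \<open>K\<close>. In a finite subcover, the index with the largest value of \<open>f\<close> would
  itself lie in some \<open>U b'\<close>, contradicting its choice.\<close>

lemma usc_on_attains_max:
  assumes "compact K" "K \<noteq> {}" "usc_on K f"
  shows "\<exists>x\<in>K. \<forall>y\<in>K. f y \<le> f x"
proof (rule ccontr)
  assume neg: "\<not> ?thesis"
  define U where "U b = {x \<in> K. f x < f b}" for b
  have op: "openin (top_of_set K) (U b)" for b
    using assms(3) by (simp add: U_def usc_on_def)
  have "\<forall>C. (\<forall>c\<in>C. openin (top_of_set K) c) \<and> K \<subseteq> \<Union>C \<longrightarrow> (\<exists>D\<subseteq>C. finite D \<and> K \<subseteq> \<Union>D)"
    using assms(1) compact_eq_openin_cover by blast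
  moreover have "K \<subseteq> \<Union>(U ` K)"
    using neg by (auto simp: U_def not_le)
  ultimately obtain D where "D \<subseteq> U ` K" "finite D" "K \<subseteq> \<Union>D"
    using op by (metis (no_types, lifting) image_iff)
  then obtain B where B: "B \<subseteq> K" "finite B" "K \<subseteq> \<Union>(U ` B)"
    using finite_subset_image[of D U K] by auto
  with assms(2) have "B \<noteq> {}" by auto
  with B have "Max (f ` B) \<in> f ` B"
    by (intro Max_in) auto
  then obtain b where b: "b \<in> B" "f b = Max (f ` B)"
    by auto
  with B obtain b' where b': "b' \<in> B" "f b < f b'"
    by (auto simp: U_def)
  with b B have "f b' \<le> f b"
    by simp
  with b' show False by simp
qed

section \<open>Compact-valued correspondences and greatest selections\<close>

text \<open>If \<open>{s} \<times> \<Gamma> s\<close> misses \<open>C\<close>, the tube lemma gives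
  a box \<open>U \<times> V\<close> around it that misses \<open>C\<close>, and upper semicontinuity
  keeps the feasible sets of nearby states inside \<open>V\<close>. Applied to superlevel sets, this
  yields both the measurability of the selection and the semicontinuity of
  \<open>bellman\<close>.\<close>

lemma closedin_usc_correspondence_image:
  assumes usc: "usc_correspondence S A \<Gamma>"
    and \<Gamma>: "\<And>s. s \<in> S \<Longrightarrow> \<Gamma> s \<subseteq> A \<and> compact (\<Gamma> s)"
    and C: "closedin (top_of_set (S \<times> A)) C"
  shows "closedin (top_of_set S) {s \<in> S. \<exists>a\<in>\<Gamma> s. (s, a) \<in> C}"
proof -
  define W where "W = S \<times> A - C"
  have W: "openin (prod_topology (top_of_set S) (top_of_set A)) W"
    using C by (simp add: W_def closedin_def)
  have "\<exists>T. openin (top_of_set S) T \<and> s \<in> T \<and> T \<subseteq> S - {s \<in> S. \<exists>a\<in>\<Gamma> s. (s, a) \<in> C}"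
    if s: "s \<in> S - {s \<in> S. \<exists>a\<in>\<Gamma> s. (s, a) \<in> C}" for s
  proof -
    from s \<Gamma> have "{s} \<times> \<Gamma> s \<subseteq> W" by (auto simp: W_def)
    moreover have "compactin (top_of_set A) (\<Gamma> s)"
      using s \<Gamma> by (auto simp: compactin_subtopology)
    ultimately obtain U V where UV: "openin (top_of_set S) U" "openin (top_of_set A) V"
        "s \<in> U" "\<Gamma> s \<subseteq> V" "U \<times> V \<subseteq> W"
      using tube_lemma_right[OF W, of "\<Gamma> s" s] s by auto
    let ?T = "U \<inter> {s \<in> S. \<Gamma> s \<subseteq> V}"
    have "openin (top_of_set S) ?T"
      using usc UV by (auto simp: usc_correspondence_def)
    moreover have "?T \<subseteq> S - {s \<in> S. \<exists>a\<in>\<Gamma> s. (s, a) \<in> C}"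
      using UV(5) by (auto simp: W_def)
    ultimately show ?thesis using UV s by blast
  qed
  then have "openin (top_of_set S) (S - {s \<in> S. \<exists>a\<in>\<Gamma> s. (s, a) \<in> C})"
    by (subst openin_subopen) blast
  then show ?thesis
    by (auto simp: closedin_def)
qed

text \<open>Each coordinate attains its maximum on \<open>K\<close> by compactness. Joining these
  maximisers one coordinate at a time stays in \<open>K\<close> and lowers no coordinate.\<close>

lemma compact_sublattice_has_greatest:
  fixes K :: "(real ^ 'k) set"
  assumes "compact K" "K \<noteq> {}" and sup: "\<And>a b. a \<in> K \<Longrightarrow> b \<in> K \<Longrightarrow> sup a b \<in> K"
  shows "\<exists>b\<in>K. \<forall>a\<in>K. a \<le> b"
proof -
  have "\<exists>b\<in>K. \<forall>i\<in>I. \<forall>a\<in>K. a $ i \<le> b $ i" if "finite I" for I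
    using that
  proof induction
    case empty
    then show ?case using assms(2) by auto
  next
    case (insert i I)
    then obtain b where b: "b \<in> K" "\<And>j a. j \<in> I \<Longrightarrow> a \<in> K \<Longrightarrow> a $ j \<le> b $ j" by blast
    obtain c where c: "c \<in> K" "\<And>a. a \<in> K \<Longrightarrow> a $ i \<le> c $ i"
      using continuous_attains_sup[OF assms(1,2) continuous_on_component[OF continuous_on_id]]
      by blast
    have "\<forall>j\<in>insert i I. \<forall>a\<in>K. a $ j \<le> sup b c $ j"
      using b c by (auto simp: sup_vec_def intro: le_supI1 le_supI2)
    with sup[OF b(1) c(1)] show ?case by blast
  qed
  from this[of UNIV] show ?thesis
    by (simp add: less_eq_vec_def) blast
qed

text \<open>By supermodularity the maximisers over \<open>\<Gamma> s\<close> form a compact sublattice; its greatest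
  element is a measurable selection because each coordinate of it is the maximum of that
  coordinate over the maximisers.\<close>

lemma supermodular_maximizer_selection:
  fixes S :: "'s::{second_countable_topology,lattice} set" and A :: "(real ^ 'k) set"
  assumes usc\<Gamma>: "usc_correspondence S A \<Gamma>"
    and \<Gamma>: "\<And>s. s \<in> S \<Longrightarrow> \<Gamma> s \<subseteq> A \<and> \<Gamma> s \<noteq> {} \<and> compact (\<Gamma> s)"
    and super\<Gamma>: "supermodular_correspondence S \<Gamma>"
    and uscg: "usc_on (S \<times> A) g" and superg: "supermodular_on (S \<times> A) g"
  shows "\<exists>\<phi>\<in>borel_on S \<rightarrow>\<^sub>M borel_on A. \<forall>s\<in>S. \<phi> s \<in> \<Gamma> s \<and> (\<forall>a\<in>\<Gamma> s. g (s, a) \<le> g (s, \<phi> s))"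
proof -
  have sec: "usc_on K (\<lambda>a. g (s, a))" if "s \<in> S" "K \<subseteq> A" for s K
    using that by (intro usc_on_compose[OF uscg]) (auto intro!: continuous_intros)
  have "\<exists>a\<in>\<Gamma> s. \<forall>b\<in>\<Gamma> s. g (s, b) \<le> g (s, a)" if "s \<in> S" for s
    using usc_on_attains_max[OF _ _ sec, of "\<Gamma> s" s] \<Gamma> that by auto
  \<comment> \<open>\<open>m\<close> is a pointwise choice without measurability; it serves to name
    the maximal value as \<open>g (s, m s)\<close>.\<close>
  then obtain m where m: "\<And>s. s \<in> S \<Longrightarrow> m s \<in> \<Gamma> s"
    and max: "\<And>s b. s \<in> S \<Longrightarrow> b \<in> \<Gamma> s \<Longrightarrow> g (s, b) \<le> g (s, m s)"
    by metis
  define G where "G s = {a \<in> \<Gamma> s. g (s, m s) \<le> g (s, a)}" for s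
  have G_compact: "compact (G s)" if "s \<in> S" for s
  proof -
    have "closedin (top_of_set (\<Gamma> s)) (G s)"
      using usc_on_closedin_ge[OF sec[of s "\<Gamma> s"]] that \<Gamma> by (simp add: G_def)
    then show ?thesis
      using \<Gamma>[OF that] closedin_compact by blast
  qed
  have G_sup: "sup a b \<in> G s" if "s \<in> S" "a \<in> G s" "b \<in> G s" for s a b
  proof -
    have ab: "a \<in> \<Gamma> s" "b \<in> \<Gamma> s" "g (s, m s) \<le> g (s, a)" "g (s, m s) \<le> g (s, b)"
      using that by (auto simp: G_def)
    with super\<Gamma> that(1) have si: "sup a b \<in> \<Gamma> s" "inf a b \<in> \<Gamma> s"
      unfolding supermodular_correspondence_def by (metis sup_idem inf_idem)+
    have "(s, a) \<in> S \<times> A" "(s, b) \<in> S \<times> A"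
      using ab that \<Gamma> by auto
    then have "g (s, a) + g (s, b) \<le> g (sup (s, a) (s, b)) + g (inf (s, a) (s, b))"
      using superg unfolding supermodular_on_def by blast
    then have "g (s, a) + g (s, b) \<le> g (s, sup a b) + g (s, inf a b)"
      by simp
    \<comment> \<open>\<open>inf a b\<close> is feasible, so its value is at most the maximum;
      supermodularity then forces \<open>sup a b\<close> to attain the maximum.\<close>
    with ab si max[OF that(1) si(2)] show ?thesis
      by (simp add: G_def)
  qed
  have G_ne: "G s \<noteq> {}" if "s \<in> S" for s
    using m[OF that] by (auto simp: G_def)
  have "\<exists>b\<in>G s. \<forall>a\<in>G s. a \<le> b" if "s \<in> S" for s
    using compact_sublattice_has_greatest[OF G_compact G_ne G_sup] that by blast
  then obtain \<phi> where \<phi>: "\<And>s. s \<in> S \<Longrightarrow> \<phi> s \<in> G s"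
    and greatest: "\<And>s a. s \<in> S \<Longrightarrow> a \<in> G s \<Longrightarrow> a \<le> \<phi> s"
    by metis
  \<comment> \<open>For a fixed level \<open>q\<close> the condition on \<open>(s, a)\<close> is
    relatively closed in \<open>S \<times> A\<close>, so the states that admit such an action form a
    closed set.\<close>
  have hit: "{s \<in> S. \<exists>a\<in>\<Gamma> s. a \<in> F \<and> q \<le> g (s, a)} \<in> sets (borel_on S)"
    if "closed F" for F q
  proof -
    have "closedin (top_of_set (S \<times> A)) ({x \<in> S \<times> A. q \<le> g x} \<inter> ((S \<times> A) \<inter> (UNIV \<times> F)))"
      using that usc_on_closedin_ge[OF uscg]
      by (intro closedin_Int closedin_closed_Int closed_Times) auto
    then have "closedin (top_of_set S)
        {s \<in> S. \<exists>a\<in>\<Gamma> s. (s, a) \<in> {x \<in> S \<times> A. q \<le> g x} \<inter> ((S \<times> A) \<inter> (UNIV \<times> F))}"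
      using \<Gamma> by (intro closedin_usc_correspondence_image[OF usc\<Gamma>]) auto
    also have "\<dots> = {s \<in> S. \<exists>a\<in>\<Gamma> s. a \<in> F \<and> q \<le> g (s, a)}"
      using \<Gamma> by fastforce
    finally show ?thesis
      by (rule closedin_sets_borel_on)
  qed
  have G_hit: "{s \<in> S. \<exists>a\<in>G s. a \<in> F} \<in> sets (borel_on S)" if F: "closed F" for F
  proof -
    \<comment> \<open>The maximal value varies with \<open>s\<close>, so rational levels replace it:
      a maximiser lies in \<open>F\<close> exactly when every rational level reached on
      \<open>\<Gamma> s\<close> is also reached on its part in \<open>F\<close>. Only countably many
      sets covered by \<open>hit\<close> are then involved.\<close>
    have iff: "(\<exists>a\<in>G s. a \<in> F) \<longleftrightarrow>
        (\<forall>q\<in>\<rat>. (\<exists>a\<in>\<Gamma> s. a \<in> UNIV \<and> q \<le> g (s, a)) \<longrightarrow> (\<exists>a\<in>\<Gamma> s. a \<in> F \<and> q \<le> g (s, a)))"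
      (is "?L \<longleftrightarrow> ?R") if s: "s \<in> S" for s
    proof
      assume ?L
      with max[OF s] show ?R by (fastforce simp: G_def)
    next
      assume R: ?R
      \<comment> \<open>One rational level below the maximum shows first that
        \<open>\<Gamma> s\<close> meets \<open>F\<close> at all.\<close>
      obtain q where "q \<in> \<rat>" "q < g (s, m s)"
        using Rats_dense_in_real[of "g (s, m s) - 1" "g (s, m s)"] by auto
      with R m[OF s] have "\<Gamma> s \<inter> F \<noteq> {}"
        by (metis IntI UNIV_I empty_iff less_imp_le)
      then obtain a where a: "a \<in> \<Gamma> s" "a \<in> F" "\<And>b. b \<in> \<Gamma> s \<Longrightarrow> b \<in> F \<Longrightarrow> g (s, b) \<le> g (s, a)"
        using usc_on_attains_max[OF _ _ sec, of "\<Gamma> s \<inter> F" s] \<Gamma>[OF s] F s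
        by (metis IntD1 IntD2 IntI compact_Int_closed le_infI1)
      have "g (s, m s) \<le> g (s, a)"
      proof (rule ccontr)
        assume "\<not> ?thesis"
        then obtain q where "q \<in> \<rat>" "g (s, a) < q" "q < g (s, m s)"
          using Rats_dense_in_real[of "g (s, a)" "g (s, m s)"] by auto
        moreover from this R m[OF s] obtain b where "b \<in> \<Gamma> s" "b \<in> F" "q \<le> g (s, b)"
          by (metis UNIV_I less_imp_le)
        ultimately show False
          using a(3)[of b] by linarith
      qed
      with a show ?L by (auto simp: G_def)
    qed
    have "{s \<in> S. \<exists>a\<in>G s. a \<in> F} = (\<Inter>q\<in>\<rat>.
        (S - {s \<in> S. \<exists>a\<in>\<Gamma> s. a \<in> UNIV \<and> q \<le> g (s, a)}) \<union> {s \<in> S. \<exists>a\<in>\<Gamma> s. a \<in> F \<and> q \<le> g (s, a)})"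
      (is "_ = (\<Inter>q\<in>\<rat>. ?D q)")
    proof (rule set_eqI)
      fix s
      show "s \<in> {s \<in> S. \<exists>a\<in>G s. a \<in> F} \<longleftrightarrow> s \<in> (\<Inter>q\<in>\<rat>. ?D q)"
      proof (cases "s \<in> S")
        case True
        then show ?thesis by (simp add: iff imp_conv_disj)
      next
        case False
        \<comment> \<open>Every \<open>?D q\<close> lies inside \<open>S\<close>; one index, here 0,
          suffices to exclude \<open>s\<close> from the intersection.\<close>
        then show ?thesis using Rats_0 by blast
      qed
    qed
    also have "\<dots> \<in> sets (borel_on S)"
    proof (rule sets.countable_INT')
      show "?D ` \<rat> \<subseteq> sets (borel_on S)"
        using hit[OF F] hit[OF closed_UNIV] sets.top[of "borel_on S"]
        by (auto intro!: sets.Un sets.Diff simp: space_restrict_space)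
    qed (use Rats_0 countable_rat in auto)
    finally show ?thesis .
  qed
  have "(\<lambda>s. \<phi> s $ i) \<in> borel_measurable (borel_on S)" for i
    unfolding borel_measurable_iff_ge
  proof
    fix c
    \<comment> \<open>As \<open>\<phi> s\<close> is the greatest element of \<open>G s\<close>, its
      coordinate reaches \<open>c\<close> exactly when some maximiser lies in this closed
      half-space.\<close>
    have "{s \<in> space (borel_on S). c \<le> \<phi> s $ i} = {s \<in> S. \<exists>a\<in>G s. a \<in> {a. c \<le> a $ i}}"
      using \<phi> greatest by (auto simp: space_restrict_space less_eq_vec_def intro: order_trans)
    moreover have "closed {a :: real ^ 'k. c \<le> a $ i}"
      by (intro closed_Collect_le continuous_intros)
    ultimately show "{s \<in> space (borel_on S). c \<le> \<phi> s $ i} \<in> sets (borel_on S)"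
      using G_hit[of "{a. c \<le> a $ i}"] by simp
  qed
  then have "\<phi> \<in> borel_measurable (borel_on S)"
    by (subst borel_measurable_euclidean_space) (auto simp: Basis_vec_def inner_axis)
  then have "\<phi> \<in> borel_on S \<rightarrow>\<^sub>M borel_on A"
    using \<phi> \<Gamma> by (intro measurable_restrict_space2) (auto simp: space_restrict_space G_def)
  moreover have "\<phi> s \<in> \<Gamma> s \<and> (\<forall>a\<in>\<Gamma> s. g (s, a) \<le> g (s, \<phi> s))" if "s \<in> S" for s
    using \<phi>[OF that] max[OF that] by (force simp: G_def)
  ultimately show ?thesis by blast
qed

section \<open>The law of a controlled process\<close>

text \<open>The integrand varies with \<open>x\<close> too; pushing \<open>L x\<close> forward along
  \<open>Pair x\<close> turns it into one fixed function on the product, integrated against a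
  measurable kernel.\<close>

lemma borel_measurable_kernel_integral:
  fixes f :: "'a \<Rightarrow> 'b \<Rightarrow> real"
  assumes f: "(\<lambda>(x, y). f x y) \<in> borel_measurable (M \<Otimes>\<^sub>M N)"
    and L: "L \<in> M \<rightarrow>\<^sub>M subprob_algebra N"
  shows "(\<lambda>x. \<integral>y. f x y \<partial>L x) \<in> borel_measurable M"
proof -
  have "(\<lambda>x. distr (L x) (M \<Otimes>\<^sub>M N) (Pair x)) \<in> M \<rightarrow>\<^sub>M subprob_algebra (M \<Otimes>\<^sub>M N)"
    using L by (intro measurable_distr2[where M = N]) auto
  from measurable_compose[OF this integral_measurable_subprob_algebra[OF f]]
  have "(\<lambda>x. \<integral>(x, y). f x y \<partial>distr (L x) (M \<Otimes>\<^sub>M N) (Pair x)) \<in> borel_measurable M" .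
  moreover have "(\<integral>(x, y). f x y \<partial>distr (L x) (M \<Otimes>\<^sub>M N) (Pair x)) = (\<integral>y. f x y \<partial>L x)"
    if x: "x \<in> space M" for x
    using f by (subst integral_distr)
      (auto simp: measurable_cong_sets[OF subprob_measurableD(2)[OF L x] refl] x)
  ultimately show ?thesis
    by (simp cong: measurable_cong)
qed

section \<open>Marginals of an Ionescu-Tulcea measure\<close>

context Ionescu_Tulcea
begin

text \<open>\<open>C 0 (Suc n)\<close> binds \<open>C 0 n\<close> to the kernel that appends one
  draw from \<open>P n\<close>. Written as a join of measures, this gives the iterated integral for
  bounded \<open>f\<close>.\<close>

lemma integral_C_Suc:
  fixes f :: "(nat \<Rightarrow> 'a) \<Rightarrow> real"
  assumes f: "f \<in> borel_measurable (PiM {0..<Suc n} M)"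
    and bound: "\<And>x. x \<in> space (PiM {0..<Suc n} M) \<Longrightarrow> \<bar>f x\<bar> \<le> B"
  shows "(\<integral>x. f x \<partial>C 0 (Suc n) (\<lambda>_. undefined)) =
    (\<integral>h. \<integral>x. f (h(n := x)) \<partial>P n h \<partial>C 0 n (\<lambda>_. undefined))"
proof -
  \<comment> \<open>\<open>?u\<close> is the empty history, the only point of the product over no
    indices.\<close>
  let ?u = "\<lambda>_. undefined :: 'a" and ?N = "PiM {0..<Suc n} M"
  have u: "?u \<in> space (PiM {0..<0} M)"
    by (simp add: space_PiM)
  interpret C: prob_space "C 0 n ?u"
    using prob_space_C[OF u] .
  have sets_Cn: "sets (C 0 n ?u) = sets (PiM {0..<n} M)"
    using sets_C[OF u] by simp
  have eP: "eP n \<in> C 0 n ?u \<rightarrow>\<^sub>M subprob_algebra ?N"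
    using measurable_eP measurable_cong_sets[OF sets_Cn refl] by blast
  have "C 0 (Suc n) ?u = join (distr (C 0 n ?u) (subprob_algebra ?N) (eP n))"
    using bind_nonempty''[OF eP] C.not_empty by simp
  also have "integral\<^sup>L \<dots> f = (\<integral>K. integral\<^sup>L K f \<partial>distr (C 0 n ?u) (subprob_algebra ?N) (eP n))"
  proof (rule integral_join[where B = B and B' = 1])
    show "finite_measure (distr (C 0 n ?u) (subprob_algebra ?N) (eP n))"
      using C.finite_measure_distr[OF eP] .
    have "AE K in distr (C 0 n ?u) (subprob_algebra ?N) (eP n). K \<in> space (subprob_algebra ?N)"
      by (rule AE_I2) simp
    then show "AE K in distr (C 0 n ?u) (subprob_algebra ?N) (eP n). emeasure K (space K) \<le> ennreal 1"
      by eventually_elim (auto simp: space_subprob_algebra subprob_space.subprob_emeasure_le_1)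
  qed (use f bound in auto)
  also have "\<dots> = (\<integral>h. integral\<^sup>L (eP n h) f \<partial>C 0 n ?u)"
    using f by (intro integral_distr eP integral_measurable_subprob_algebra)
  also have "\<dots> = (\<integral>h. \<integral>x. f (h(n := x)) \<partial>P n h \<partial>C 0 n ?u)"
  proof (rule Bochner_Integration.integral_cong)
    fix h assume "h \<in> space (C 0 n ?u)"
    then have h: "h \<in> space (PiM {0..<n} M)"
      using space_C[OF u] by simp
    then show "integral\<^sup>L (eP n h) f = (\<integral>x. f (h(n := x)) \<partial>P n h)"
      unfolding eP_def using f
      by (intro integral_distr)
         (auto intro!: measurable_fun_upd[where J="{0..<n}"] simp: measurable_cong_sets[OF sets_P[OF h]])
  qed simp
  finally show ?thesis .
qed

text \<open>Coordinate \<open>n\<close> is read off the restriction to \<open>{0..<Suc n}\<close>,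
  whose law under the limit measure is \<open>C 0 (Suc n)\<close>; splitting off the last draw
  finishes.\<close>

lemma integral_lim_component:
  fixes F :: "'a \<Rightarrow> real"
  assumes F: "F \<in> borel_measurable (M n)" and bound: "\<And>x. x \<in> space (M n) \<Longrightarrow> \<bar>F x\<bar> \<le> B"
  shows "(\<integral>\<omega>. F (\<omega> n) \<partial>PF.lim) = (\<integral>h. \<integral>x. F x \<partial>P n h \<partial>C 0 n (\<lambda>_. undefined))"
proof -
  let ?N = "PiM {0..<Suc n} M" and ?u = "\<lambda>_. undefined :: 'a"
  have u: "?u \<in> space (PiM {0..<0} M)"
    by (simp add: space_PiM)
  have Fn: "(\<lambda>\<omega>. F (\<omega> n)) \<in> borel_measurable ?N"
    using F by (intro measurable_compose[OF measurable_component_singleton[of n]]) auto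
  \<comment> \<open>\<open>CI J\<close> is built from \<open>C\<close> up to the least strict upper
    bound of \<open>J\<close>, so here no draw after time \<open>n\<close> is involved.\<close>
  have up: "up_to {0..<Suc n} = Suc n"
    using up_to_iff_Ico[of "{0..<Suc n}" "Suc n"] up_to[of "{0..<Suc n}"]
    by (simp add: le_antisym)
  have sets_CSn: "sets (C 0 (Suc n) ?u) = sets ?N"
    using sets_C[OF u, of "Suc n"] by (simp only: add_0)
  have restr: "(\<lambda>\<omega>. restrict \<omega> {0..<Suc n}) \<in> PF.lim \<rightarrow>\<^sub>M ?N"
    "(\<lambda>\<omega>. restrict \<omega> {0..<Suc n}) \<in> C 0 (Suc n) ?u \<rightarrow>\<^sub>M ?N"
    unfolding measurable_cong_sets[OF PF.sets_lim refl] measurable_cong_sets[OF sets_CSn refl]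
    by (rule measurable_restrict_subset, simp)+
  have "(\<integral>\<omega>. F (\<omega> n) \<partial>PF.lim) = (\<integral>\<omega>. F (restrict \<omega> {0..<Suc n} n) \<partial>PF.lim)"
    by simp
  also have "\<dots> = (\<integral>\<omega>. F (\<omega> n) \<partial>distr PF.lim ?N (\<lambda>\<omega>. restrict \<omega> {0..<Suc n}))"
    using restr(1) Fn by (rule integral_distr[symmetric])
  also have "\<dots> = (\<integral>\<omega>. F (\<omega> n) \<partial>CI {0..<Suc n})"
    by (simp add: distr_lim)
  also have "\<dots> = (\<integral>\<omega>. F (restrict \<omega> {0..<Suc n} n) \<partial>C 0 (Suc n) ?u)"
    unfolding CI_def up using restr(2) Fn by (rule integral_distr)
  also have "\<dots> = (\<integral>\<omega>. F (\<omega> n) \<partial>C 0 (Suc n) ?u)"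
    by simp
  also have "\<dots> = (\<integral>h. \<integral>x. F ((h(n := x)) n) \<partial>P n h \<partial>C 0 n ?u)"
    by (intro integral_C_Suc[OF Fn, of B] bound) (auto simp: space_PiM PiE_iff)
  finally show ?thesis by simp
qed

text \<open>Push-forwards preserve total mass, and the marginal on the empty index set is a
  probability measure.\<close>

lemma prob_space_lim: "prob_space PF.lim"
proof -
  have "prob_space (distr PF.lim (PiM {} M) (\<lambda>x. restrict x {}))"
    unfolding distr_lim[OF finite.emptyI] by (rule PF.prob_space_P) auto
  moreover have "(\<lambda>x. restrict x {}) \<in> PF.lim \<rightarrow>\<^sub>M PiM {} M"
    unfolding measurable_cong_sets[OF PF.sets_lim refl] by (rule measurable_restrict_subset) simp
  ultimately show ?thesis
    by (blast intro: prob_space_distrD)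
qed

end

section \<open>The state-action process of one strategy from one initial state\<close>

locale controlled_process =
  fixes S :: "'s::second_countable_topology set" and A :: "'a::second_countable_topology set"
    and p :: "'s \<times> 'a \<Rightarrow> 's measure" and \<sigma> :: "('s, 'a) strategy" and s :: 's
  assumes p[measurable]: "p \<in> borel_on (S \<times> A) \<rightarrow>\<^sub>M prob_algebra (borel_on S)"
    and \<sigma>: "\<And>t. \<sigma> t \<in> histories S A t \<rightarrow>\<^sub>M borel_on A"
    and s: "s \<in> S"
begin

abbreviation paths :: "nat \<Rightarrow> (nat \<Rightarrow> 's \<times> 'a) measure" where
  "paths t \<equiv> PiM {0..<t} (\<lambda>_. borel_on (S \<times> A))"

lemma measurable_state_law:
  "state_law S p s t \<in> paths t \<rightarrow>\<^sub>M prob_algebra (borel_on S)"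
proof (cases t)
  case 0
  then show ?thesis
    using s by (auto simp: state_law.simps(1)[abs_def] space_prob_algebra space_restrict_space
        intro!: measurable_const prob_space_return)
next
  case (Suc n)
  then show ?thesis
    using measurable_compose[OF measurable_component_singleton[of n "{0..<t}"] p]
    by (simp add: state_law.simps(2)[abs_def])
qed

lemma measurable_action: "(\<lambda>(h, x). (x, \<sigma> t (h, x))) \<in> histories S A t \<rightarrow>\<^sub>M borel_on (S \<times> A)"
proof -
  have "snd \<in> histories S A t \<rightarrow>\<^sub>M borel" "\<sigma> t \<in> histories S A t \<rightarrow>\<^sub>M borel"
    using measurable_snd[of "paths t" "borel_on S"] \<sigma>[of t]
    by (simp_all add: measurable_restrict_space2_iff)
  \<comment> \<open>By second countability the Borel sets of the product type are the product ones,
    so pairing is measurable; the range is cut down to \<open>S \<times> A\<close>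
    afterwards.\<close>
  then have "(\<lambda>y. (snd y, \<sigma> t y)) \<in> histories S A t \<rightarrow>\<^sub>M borel"
    unfolding borel_prod[symmetric, where 'a = 's and 'b = 'a] by (rule measurable_Pair)
  moreover have "\<sigma> t y \<in> A" if "y \<in> space (histories S A t)" for y
    using measurable_space[OF \<sigma> that] by (simp add: space_restrict_space)
  ultimately show ?thesis
    by (intro measurable_restrict_space2)
       (auto simp: case_prod_beta' space_pair_measure space_restrict_space)
qed

lemma measurable_step_law:
  "step_law S A p \<sigma> s t \<in> paths t \<rightarrow>\<^sub>M prob_algebra (borel_on (S \<times> A))"
  unfolding step_law_def[abs_def]
  using measurable_state_law measurable_action by (rule measurable_distr_prob_space2)

sublocale Ionescu_Tulcea "step_law S A p \<sigma> s" "\<lambda>_. borel_on (S \<times> A)"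
proof (rule Ionescu_Tulcea.intro)
  fix t h
  show "step_law S A p \<sigma> s t \<in> paths t \<rightarrow>\<^sub>M subprob_algebra (borel_on (S \<times> A))"
    by (rule measurable_prob_algebraD[OF measurable_step_law])
  assume "h \<in> space (paths t)"
  from measurable_space[OF measurable_step_law this]
  show "prob_space (step_law S A p \<sigma> s t h)"
    by (simp add: space_prob_algebra)
qed

abbreviation "law \<equiv> play_law S A p \<sigma> s"
text \<open>The law of the pairs at times before \<open>t\<close>, started from the empty
  history.\<close>

abbreviation "past t \<equiv> C 0 t (\<lambda>_. undefined)"

lemma prob_space_law: "prob_space law"
  unfolding play_law_def by (rule prob_space_lim)

lemma sets_law: "sets law = sets (PiM UNIV (\<lambda>_. borel_on (S \<times> A)))"
  unfolding play_law_def by (rule PF.sets_lim)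

lemma space_law: "space law = {\<omega>. \<forall>t. \<omega> t \<in> S \<times> A}"
  using sets_eq_imp_space_eq[OF sets_law] by (auto simp: space_PiM space_restrict_space PiE_iff)

lemma prob_space_past: "prob_space (past t)"
  by (rule prob_space_C) (simp add: space_PiM)

lemma space_past: "space (past t) = space (paths t)"
  by (subst space_C) (auto simp: space_PiM)

lemma sets_past: "sets (past t) = sets (paths t)"
  by (subst sets_C) (auto simp: space_PiM)

lemma action_in: "h \<in> space (paths t) \<Longrightarrow> x \<in> S \<Longrightarrow> (x, \<sigma> t (h, x)) \<in> S \<times> A"
  using measurable_space[OF measurable_action, of "(h, x)" t]
  by (simp add: space_pair_measure space_restrict_space)

lemma state_law_props:
  assumes "h \<in> space (paths t)"
  shows "sets (state_law S p s t h) = sets (borel_on S)" "prob_space (state_law S p s t h)"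
    "space (state_law S p s t h) = S"
  using measurable_space[OF measurable_state_law assms] sets_eq_imp_space_eq
  by (auto simp: space_prob_algebra space_restrict_space dest: sets_eq_imp_space_eq)

lemma measurable_section:
  assumes "h \<in> space (paths t)"
  shows "(\<lambda>x. (x, \<sigma> t (h, x))) \<in> borel_on S \<rightarrow>\<^sub>M borel_on (S \<times> A)"
  using measurable_compose[OF measurable_Pair1'[OF assms] measurable_action] by simp

lemma integral_step_law:
  fixes F :: "'s \<times> 'a \<Rightarrow> real"
  assumes "F \<in> borel_measurable (borel_on (S \<times> A))" "h \<in> space (paths t)"
  shows "(\<integral>y. F y \<partial>step_law S A p \<sigma> s t h) = (\<integral>x. F (x, \<sigma> t (h, x)) \<partial>state_law S p s t h)"
  unfolding step_law_def using assms(1)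
  by (intro integral_distr) (simp_all add: measurable_cong_sets[OF state_law_props(1)[OF assms(2)] refl]
        measurable_section[OF assms(2)])

lemma integral_play:
  assumes "F \<in> borel_measurable (borel_on (S \<times> A))" "\<And>y. y \<in> S \<times> A \<Longrightarrow> \<bar>F y\<bar> \<le> (B::real)"
  shows "(\<integral>\<omega>. F (\<omega> t) \<partial>law) =
    (\<integral>h. \<integral>x. F (x, \<sigma> t (h, x)) \<partial>state_law S p s t h \<partial>past t)"
  unfolding play_law_def
  using assms
  by (subst integral_lim_component[where B = B])
     (auto simp: space_restrict_space space_past integral_step_law intro!: Bochner_Integration.integral_cong)

text \<open>The last pair of a past of length \<open>Suc t\<close> is drawn by the step law at
  \<open>t\<close>. This lets an expectation at time \<open>Suc t\<close> be compared with payoffs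
  at time \<open>t\<close>.\<close>

lemma integral_past_Suc:
  assumes "F \<in> borel_measurable (borel_on (S \<times> A))" "\<And>y. y \<in> S \<times> A \<Longrightarrow> \<bar>F y\<bar> \<le> (B::real)"
  shows "(\<integral>h. F (h t) \<partial>past (Suc t)) =
    (\<integral>h. \<integral>x. F (x, \<sigma> t (h, x)) \<partial>state_law S p s t h \<partial>past t)"
proof -
  have "(\<lambda>h. F (h t)) \<in> borel_measurable (paths (Suc t))"
    using measurable_compose[OF measurable_component_singleton[of t] assms(1)] by simp
  then show ?thesis
    using assms
    by (subst integral_C_Suc[where B = B])
       (auto simp: space_PiM PiE_iff space_restrict_space space_past integral_step_law
         intro!: Bochner_Integration.integral_cong)
qed

lemma kernel_integral:
  assumes f: "f \<in> borel_measurable (borel_on S)" and B: "\<And>x. x \<in> S \<Longrightarrow> \<bar>f x\<bar> \<le> (B::real)"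
  shows "(\<lambda>y. \<integral>x. f x \<partial>p y) \<in> borel_measurable (borel_on (S \<times> A))"
    and "\<And>y. y \<in> S \<times> A \<Longrightarrow> \<bar>\<integral>x. f x \<partial>p y\<bar> \<le> B"
proof -
  show "(\<lambda>y. \<integral>x. f x \<partial>p y) \<in> borel_measurable (borel_on (S \<times> A))"
    using measurable_compose[OF measurable_prob_algebraD[OF p] integral_measurable_subprob_algebra[OF f]] .
  fix y assume "y \<in> S \<times> A"
  then have "p y \<in> space (prob_algebra (borel_on S))"
    using measurable_space[OF p] by (simp add: space_restrict_space)
  then have py: "prob_space (p y)" "sets (p y) = sets (borel_on S)" "space (p y) = S"
    by (auto simp: space_prob_algebra space_restrict_space dest: sets_eq_imp_space_eq)
  interpret prob_space "p y" by fact
  have "integrable (p y) f"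
    using f B py(3)
    by (intro integrable_const_bound[of _ B]) (auto simp: measurable_cong_sets[OF py(2) refl])
  then show "\<bar>\<integral>x. f x \<partial>p y\<bar> \<le> B"
    using integral_le_const[of f B] integral_ge_const[of f "- B"] B py
    by (auto simp: abs_le_iff minus_le_iff)
qed

text \<open>Below, \<open>d t\<close> is the expectation of \<open>w t\<close> at the state of time \<open>t\<close>. Supersolutions are
  covered by negating both \<open>w\<close> and \<open>r\<close>.\<close>

lemma subsolution_le_truncated_value:
  fixes w :: "nat \<Rightarrow> 's \<Rightarrow> real" and r :: "'s \<times> 'a \<Rightarrow> real"
  assumes r: "r \<in> borel_measurable (borel_on (S \<times> A))" "\<And>y. y \<in> S \<times> A \<Longrightarrow> \<bar>r y\<bar> \<le> K"
    and w: "\<And>t. w t \<in> borel_measurable (borel_on S)" "\<And>t x. x \<in> S \<Longrightarrow> \<bar>w t x\<bar> \<le> B"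
    and \<beta>: "0 \<le> \<beta>" and end0: "\<And>x. x \<in> S \<Longrightarrow> w n x = 0"
    and step: "\<And>t h x. t < n \<Longrightarrow> h \<in> space (paths t) \<Longrightarrow> x \<in> S \<Longrightarrow>
      w t x \<le> r (x, \<sigma> t (h, x)) + \<beta> * (\<integral>x'. w (Suc t) x' \<partial>p (x, \<sigma> t (h, x)))"
  shows "w 0 s \<le> (\<Sum>t<n. \<beta> ^ t * (\<integral>\<omega>. r (\<omega> t) \<partial>law))"
proof -
  define d where "d t = (\<integral>h. \<integral>x. w t x \<partial>state_law S p s t h \<partial>past t)" for t
  define q where "q t y = (\<integral>x'. w t x' \<partial>p y)" for t y
  \<comment> \<open>\<open>F t\<close> is the right-hand side of the hypothesis \<open>step\<close>
    as a function of the current pair.\<close>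
  define F where "F t y = r y + \<beta> * q (Suc t) y" for t y
  have q: "q t \<in> borel_measurable (borel_on (S \<times> A))" "\<And>y. y \<in> S \<times> A \<Longrightarrow> \<bar>q t y\<bar> \<le> B" for t
    using kernel_integral[OF w] by (auto simp: q_def[abs_def])
  have F: "F t \<in> borel_measurable (borel_on (S \<times> A))" for t
    unfolding F_def[abs_def] using r q by measurable
  have Fb: "\<bar>F t y\<bar> \<le> K + \<beta> * B" if "y \<in> S \<times> A" for t y
  proof -
    have "\<bar>F t y\<bar> \<le> \<bar>r y\<bar> + \<beta> * \<bar>q (Suc t) y\<bar>"
      unfolding F_def using \<beta> abs_triangle_ineq[of "r y" "\<beta> * q (Suc t) y"] by (simp add: abs_mult)
    also have "\<dots> \<le> K + \<beta> * B"
      using r(2)[OF that] q(2)[OF that] \<beta> by (intro add_mono mult_left_mono)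
    finally show ?thesis .
  qed
  \<comment> \<open>The state at time \<open>Suc t\<close> is drawn from \<open>p\<close> at the
    last pair of the past, so its conditional law depends on that pair alone.\<close>
  have d_Suc: "d (Suc t) = (\<integral>h. q (Suc t) (h t) \<partial>past (Suc t))" for t
    by (simp add: d_def q_def)
  have d_step: "d t \<le> (\<integral>\<omega>. r (\<omega> t) \<partial>law) + \<beta> * d (Suc t)" if t: "t < n" for t
  proof -
    interpret past: prob_space "past t" by (rule prob_space_past)
    have int_state: "integrable (state_law S p s t h) f"
      if "f \<in> borel_measurable (borel_on S)" "\<And>x. x \<in> S \<Longrightarrow> \<bar>f x\<bar> \<le> (b::real)" "h \<in> space (paths t)"
      for f b h
    proof -
      interpret prob_space "state_law S p s t h" using state_law_props[OF that(3)] by simp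
      show ?thesis
        using that(1,2) state_law_props(3)[OF that(3)]
        by (intro integrable_const_bound[of _ b])
           (auto simp: measurable_cong_sets[OF state_law_props(1)[OF that(3)] refl])
    qed
    \<comment> \<open>The inner integral is a kernel integral, hence measurable in \<open>h\<close>,
      and it inherits the bound of \<open>f\<close>.\<close>
    have int_past: "integrable (past t) (\<lambda>h. \<integral>x. f h x \<partial>state_law S p s t h)"
      if f: "(\<lambda>(h, x). f h x) \<in> borel_measurable (histories S A t)"
        and b: "\<And>h x. h \<in> space (paths t) \<Longrightarrow> x \<in> S \<Longrightarrow> \<bar>f h x\<bar> \<le> (b::real)" for f b
    proof (rule past.integrable_const_bound[of _ b])
      show "AE h in past t. norm (\<integral>x. f h x \<partial>state_law S p s t h) \<le> b"
      proof (rule AE_I2)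
        fix h assume "h \<in> space (past t)"
        then have h: "h \<in> space (paths t)" by (simp add: space_past)
        interpret prob_space "state_law S p s t h" using state_law_props[OF h] by simp
        have "f h \<in> borel_measurable (borel_on S)"
          using measurable_compose[OF measurable_Pair1'[OF h] f] by simp
        from int_state[OF this b[OF h] h]
        have "integrable (state_law S p s t h) (f h)" by blast
        then show "norm (\<integral>x. f h x \<partial>state_law S p s t h) \<le> b"
          using integral_le_const[of "f h" b] integral_ge_const[of "f h" "- b"] b[OF h] state_law_props[OF h]
          by (auto simp: abs_le_iff minus_le_iff)
      qed
      have "(\<lambda>h. \<integral>x. f h x \<partial>state_law S p s t h) \<in> borel_measurable (paths t)"
        using f measurable_prob_algebraD[OF measurable_state_law]
        by (rule borel_measurable_kernel_integral)
      then show "(\<lambda>h. \<integral>x. f h x \<partial>state_law S p s t h) \<in> borel_measurable (past t)"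
        using measurable_cong_sets[OF sets_past] by blast
    qed
    have comp: "(\<lambda>(h, x). G (x, \<sigma> t (h, x))) \<in> borel_measurable (histories S A t)"
      if "G \<in> borel_measurable (borel_on (S \<times> A))" for G :: "'s \<times> 'a \<Rightarrow> real"
      using measurable_compose[OF measurable_action that] by (simp add: case_prod_beta')
    have sec: "(\<lambda>x. G (x, \<sigma> t (h, x))) \<in> borel_measurable (borel_on S)"
      if "G \<in> borel_measurable (borel_on (S \<times> A))" "h \<in> space (paths t)" for G :: "'s \<times> 'a \<Rightarrow> real" and h
      using measurable_compose[OF measurable_section that(1)] that(2) by simp
    have wh: "(\<lambda>(h, x). w t x) \<in> borel_measurable (histories S A t)"
      using measurable_compose[OF measurable_snd w(1)] by (simp add: case_prod_beta')
    have "d t \<le> (\<integral>h. \<integral>x. F t (x, \<sigma> t (h, x)) \<partial>state_law S p s t h \<partial>past t)"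
      unfolding d_def
    proof (rule integral_mono)
      show "integrable (past t) (\<lambda>h. \<integral>x. w t x \<partial>state_law S p s t h)"
        using w(2) by (intro int_past[OF wh]) auto
      show "integrable (past t) (\<lambda>h. \<integral>x. F t (x, \<sigma> t (h, x)) \<partial>state_law S p s t h)"
        using Fb action_in by (intro int_past[OF comp[OF F]]) blast
      fix h assume "h \<in> space (past t)"
      then have h: "h \<in> space (paths t)" by (simp add: space_past)
      show "(\<integral>x. w t x \<partial>state_law S p s t h) \<le> (\<integral>x. F t (x, \<sigma> t (h, x)) \<partial>state_law S p s t h)"
      proof (rule integral_mono)
        show "integrable (state_law S p s t h) (w t)"
          using w h by (intro int_state) auto
        show "integrable (state_law S p s t h) (\<lambda>x. F t (x, \<sigma> t (h, x)))"
          using Fb action_in[OF h] by (intro int_state[OF sec[OF F h] _ h]) blast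
      qed (use step[OF t h] state_law_props(3)[OF h] in \<open>simp add: F_def q_def\<close>)
    qed
    also have "\<dots> = (\<integral>h. (\<integral>x. r (x, \<sigma> t (h, x)) \<partial>state_law S p s t h)
        + \<beta> * (\<integral>x. q (Suc t) (x, \<sigma> t (h, x)) \<partial>state_law S p s t h) \<partial>past t)"
    proof (rule Bochner_Integration.integral_cong)
      fix h assume "h \<in> space (past t)"
      then have h: "h \<in> space (paths t)" by (simp add: space_past)
      show "(\<integral>x. F t (x, \<sigma> t (h, x)) \<partial>state_law S p s t h) =
          (\<integral>x. r (x, \<sigma> t (h, x)) \<partial>state_law S p s t h)
          + \<beta> * (\<integral>x. q (Suc t) (x, \<sigma> t (h, x)) \<partial>state_law S p s t h)"
        unfolding F_def
        using int_state[OF sec[OF r(1) h] r(2)[OF action_in[OF h]] h]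
          int_state[OF sec[OF q(1) h] q(2)[OF action_in[OF h]] h]
        by simp
    qed simp
    also have "\<dots> = (\<integral>h. \<integral>x. r (x, \<sigma> t (h, x)) \<partial>state_law S p s t h \<partial>past t)
        + \<beta> * (\<integral>h. \<integral>x. q (Suc t) (x, \<sigma> t (h, x)) \<partial>state_law S p s t h \<partial>past t)"
      using int_past[OF comp[OF r(1)] r(2)[OF action_in]]
        int_past[OF comp[OF q(1)] q(2)[OF action_in]] by simp
    also have "\<dots> = (\<integral>\<omega>. r (\<omega> t) \<partial>law) + \<beta> * d (Suc t)"
      unfolding d_Suc using integral_play[OF r] integral_past_Suc[OF q] by simp
    finally show ?thesis .
  qed
  \<comment> \<open>The initial state law is the point mass at \<open>s\<close>, and
    \<open>past 0\<close> has total mass 1.\<close>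
  have "w 0 s = d 0"
  proof -
    interpret prob_space "past 0" by (rule prob_space_past)
    have "(\<integral>x. w 0 x \<partial>return (borel_on S) s) = w 0 s"
      using w s by (intro integral_return) (auto simp: space_restrict_space)
    then show ?thesis
      by (simp add: d_def prob_space del: C.simps)
  qed
  \<comment> \<open>Iterating \<open>d_step\<close> with discount \<open>\<beta> ^ m\<close>
    collects the payoffs before time \<open>m\<close>. At \<open>m = n\<close> the remainder
    vanishes, because \<open>w n\<close> does.\<close>
  also have "d 0 \<le> (\<Sum>t<m. \<beta> ^ t * (\<integral>\<omega>. r (\<omega> t) \<partial>law)) + \<beta> ^ m * d m" if "m \<le> n" for m
    using that
  proof (induction m)
    case (Suc m)
    then have "\<beta> ^ m * d m \<le> \<beta> ^ m * ((\<integral>\<omega>. r (\<omega> m) \<partial>law) + \<beta> * d (Suc m))"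
      using \<beta> by (intro mult_left_mono d_step) auto
    with Suc show ?case by (simp add: algebra_simps)
  qed simp
  from this[of n] have "d 0 \<le> (\<Sum>t<n. \<beta> ^ t * (\<integral>\<omega>. r (\<omega> t) \<partial>law)) + \<beta> ^ n * d n" by simp
  also have "d n = (\<integral>h. \<integral>x. 0 \<partial>state_law S p s n h \<partial>past n)"
    unfolding d_def using end0
    by (intro Bochner_Integration.integral_cong) (auto simp: space_past state_law_props)
  finally show ?thesis by simp
qed

text \<open>On every play the payoffs from time \<open>n\<close> on are dominated by a geometric
  tail. The bound is the same for all plays, so it survives taking expectations.\<close>

lemma strategy_value_truncation:
  assumes r: "r \<in> borel_measurable (borel_on (S \<times> A))" "\<And>y. y \<in> S \<times> A \<Longrightarrow> \<bar>r y\<bar> \<le> K"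
    and \<beta>: "0 \<le> \<beta>" "\<beta> < 1"
  shows "\<bar>strategy_value S A p r \<beta> \<sigma> s - (\<Sum>t<n. \<beta> ^ t * (\<integral>\<omega>. r (\<omega> t) \<partial>law))\<bar> \<le> \<beta> ^ n * K / (1 - \<beta>)"
proof -
  interpret prob_space law by (rule prob_space_law)
  have m: "(\<lambda>\<omega>. r (\<omega> t)) \<in> borel_measurable law" for t
    unfolding measurable_cong_sets[OF sets_law refl]
    using measurable_compose[OF measurable_component_singleton[of t UNIV] r(1)] by simp
  then have int: "integrable law (\<lambda>\<omega>. r (\<omega> t))" for t
    by (intro integrable_const_bound[of _ K]) (auto simp: space_law intro!: AE_I2 r(2))
  have term_le: "norm (\<beta> ^ t * r (\<omega> t)) \<le> K * \<beta> ^ t" if "\<omega> \<in> space law" for \<omega> t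
    using that mult_left_mono[OF r(2)[of "\<omega> t"], of "\<beta> ^ t"] \<beta>
    by (simp add: space_law abs_mult mult.commute)
  have geom: "summable (\<lambda>t. K * \<beta> ^ t)"
    using \<beta> by (intro summable_mult summable_geometric) simp
  have summ: "summable (\<lambda>t. \<beta> ^ t * r (\<omega> t))" if "\<omega> \<in> space law" for \<omega>
    using geom by (rule summable_comparison_test') (rule term_le[OF that])
  let ?f = "\<lambda>\<omega>. (\<Sum>t. \<beta> ^ t * r (\<omega> t))" and ?g = "\<lambda>\<omega>. \<Sum>t<n. \<beta> ^ t * r (\<omega> t)"
  have diff: "\<bar>?f \<omega> - ?g \<omega>\<bar> \<le> \<beta> ^ n * K / (1 - \<beta>)" if "\<omega> \<in> space law" for \<omega>
  proof -
    have "?f \<omega> - ?g \<omega> = (\<Sum>t. \<beta> ^ (t + n) * r (\<omega> (t + n)))"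
      using suminf_split_initial_segment[OF summ[OF that], of n] by simp
    also have "norm \<dots> \<le> (\<Sum>t. K * \<beta> ^ (t + n))"
      by (intro norm_suminf_le term_le[OF that] summable_ignore_initial_segment geom)
    also have "\<dots> = K * \<beta> ^ n * (\<Sum>t. \<beta> ^ t)"
      using suminf_mult[of "\<lambda>t. \<beta> ^ t" "K * \<beta> ^ n"] summable_geometric[of \<beta>] \<beta>
      by (simp add: power_add mult_ac)
    also have "\<dots> = \<beta> ^ n * K / (1 - \<beta>)"
      using \<beta> by (simp add: suminf_geometric)
    finally show ?thesis by simp
  qed
  have fm: "?f \<in> borel_measurable law"
    using m by measurable
  have intg: "integrable law ?g"
    using int by (intro Bochner_Integration.integrable_sum integrable_mult_right)
  \<comment> \<open>The infinite sum is integrable because it differs from an integrable finite sum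
    by a bounded measurable function.\<close>
  have intd: "integrable law (\<lambda>\<omega>. ?f \<omega> - ?g \<omega>)"
    using fm intg diff by (intro integrable_const_bound[of _ "\<beta> ^ n * K / (1 - \<beta>)"]) auto
  have "integrable law ?f"
    using Bochner_Integration.integrable_add[OF intd intg] by simp
  then have "strategy_value S A p r \<beta> \<sigma> s - (\<Sum>t<n. \<beta> ^ t * (\<integral>\<omega>. r (\<omega> t) \<partial>law)) = (\<integral>\<omega>. ?f \<omega> - ?g \<omega> \<partial>law)"
    using intg int by (simp add: strategy_value_def)
  moreover have "(\<integral>\<omega>. ?f \<omega> - ?g \<omega> \<partial>law) \<le> \<beta> ^ n * K / (1 - \<beta>)"
    using diff by (intro integral_le_const[OF intd] AE_I2) (rule abs_le_D1)
  moreover have "- (\<beta> ^ n * K / (1 - \<beta>)) \<le> ?f \<omega> - ?g \<omega>" if "\<omega> \<in> space law" for \<omega>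
    using diff[OF that] by linarith
  then have "- (\<beta> ^ n * K / (1 - \<beta>)) \<le> (\<integral>\<omega>. ?f \<omega> - ?g \<omega> \<partial>law)"
    by (intro integral_ge_const[OF intd] AE_I2)
  ultimately show ?thesis
    by linarith
qed

end

section \<open>Finite-horizon values\<close>

locale supermodular_decision_process =
  fixes S :: "'s::{second_countable_topology,lattice} set" and A :: "(real ^ 'k) set"
    and \<Gamma> :: "'s \<Rightarrow> (real ^ 'k) set" and p :: "'s \<times> (real ^ 'k) \<Rightarrow> 's measure"
    and r :: "'s \<times> (real ^ 'k) \<Rightarrow> real" and \<beta> :: real
  assumes beta: "0 < \<beta>" "\<beta> < 1"
    and p: "p \<in> borel_on (S \<times> A) \<rightarrow>\<^sub>M prob_algebra (borel_on S)"
    and usc_p: "usc_kernel S A p"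
    and bounded_r: "bounded (r ` (S \<times> A))"
    and usc_r: "usc_on (S \<times> A) r"
    and feasible: "\<And>s. s \<in> S \<Longrightarrow> \<Gamma> s \<subseteq> A \<and> \<Gamma> s \<noteq> {} \<and> compact (\<Gamma> s)"
    and usc_\<Gamma>: "usc_correspondence S A \<Gamma>"
    and lattice_S: "is_lattice S"
    and super_r: "supermodular_on (S \<times> A) r"
    and super_p: "supermodular_kernel S A p"
    and super_\<Gamma>: "supermodular_correspondence S \<Gamma>"
begin

definition action_value :: "('s \<Rightarrow> real) \<Rightarrow> 's \<times> (real ^ 'k) \<Rightarrow> real" where
  "action_value f x = r x + \<beta> * (\<integral>s'. f s' \<partial>p x)"

definition bellman :: "('s \<Rightarrow> real) \<Rightarrow> 's \<Rightarrow> real" where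
  "bellman f s = (SUP a\<in>\<Gamma> s. action_value f (s, a))"

text \<open>The class that \<open>bellman\<close> preserves: semicontinuity and boundedness are what
  \<open>usc_kernel\<close> transports to \<open>S \<times> A\<close>, and supermodularity is what
  \<open>supermodular_kernel\<close> transports and the selection of maximisers uses.\<close>

definition admissible :: "('s \<Rightarrow> real) \<Rightarrow> bool" where
  "admissible f \<longleftrightarrow> usc_on S f \<and> bounded (f ` S) \<and> supermodular_on S f"

lemma borel_measurable_r: "r \<in> borel_measurable (borel_on (S \<times> A))"
  by (rule borel_measurable_usc_on[OF usc_r])

lemma action_value_props:
  assumes f: "admissible f"
  shows "usc_on (S \<times> A) (action_value f)" "bounded (action_value f ` (S \<times> A))"
    "supermodular_on (S \<times> A) (action_value f)"
proof -
  let ?q = "\<lambda>x. \<integral>s'. f s' \<partial>p x"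
  have fm: "f \<in> borel_measurable (borel_on S)"
    using f by (auto simp: admissible_def intro: borel_measurable_usc_on)
  obtain B where B: "\<And>x. x \<in> S \<Longrightarrow> \<bar>f x\<bar> \<le> B"
    using f by (auto simp: admissible_def bounded_iff)
  have q: "usc_on (S \<times> A) ?q" "bounded (?q ` (S \<times> A))"
    using f usc_p by (auto simp: admissible_def usc_kernel_def)
  then show "usc_on (S \<times> A) (action_value f)"
    unfolding action_value_def[abs_def] using beta by (intro usc_on_add usc_r usc_on_cmult)
  show "bounded (action_value f ` (S \<times> A))"
    unfolding action_value_def[abs_def]
    using q(2) by (intro bounded_plus_comp bounded_r) (simp add: bounded_iff abs_mult,
      metis abs_ge_zero beta(1) less_imp_le mult_left_mono abs_of_pos)
  \<comment> \<open>\<open>supermodular_kernel\<close> speaks only of functions integrable under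
    every \<open>p x\<close>; boundedness of \<open>f\<close> supplies this.\<close>
  have "integrable (p x) f" if "x \<in> S \<times> A" for x
  proof -
    have "p x \<in> space (prob_algebra (borel_on S))"
      using measurable_space[OF p] that by (simp add: space_restrict_space)
    then have px: "prob_space (p x)" "sets (p x) = sets (borel_on S)" "space (p x) = S"
      by (auto simp: space_prob_algebra space_restrict_space dest: sets_eq_imp_space_eq)
    interpret prob_space "p x" by fact
    show ?thesis
      using fm B px(3)
      by (intro integrable_const_bound[of _ B]) (auto simp: measurable_cong_sets[OF px(2) refl])
  qed
  then have "supermodular_on (S \<times> A) ?q"
    using super_p f fm unfolding supermodular_kernel_def admissible_def by blast
  then show "supermodular_on (S \<times> A) (action_value f)"
    unfolding supermodular_on_def action_value_def
  proof (intro ballI)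
    fix x y assume "x \<in> S \<times> A" "y \<in> S \<times> A"
      and "\<forall>x\<in>S \<times> A. \<forall>x'\<in>S \<times> A. ?q x + ?q x' \<le> ?q (sup x x') + ?q (inf x x')"
    then have "\<beta> * (?q x + ?q y) \<le> \<beta> * (?q (sup x y) + ?q (inf x y))"
        "r x + r y \<le> r (sup x y) + r (inf x y)"
      using super_r beta by (auto simp: supermodular_on_def simp del: sup_Pair_Pair inf_Pair_Pair)
    then show "r x + \<beta> * ?q x + (r y + \<beta> * ?q y)
        \<le> r (sup x y) + \<beta> * ?q (sup x y) + (r (inf x y) + \<beta> * ?q (inf x y))"
      by (simp add: distrib_left)
  qed
qed

text \<open>The supremum is attained by a measurable rule; such rules later make up the strategy
  that is optimal over a finite horizon.\<close>

lemma bellman_selection: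
  assumes f: "admissible f"
  shows "\<exists>\<phi>\<in>borel_on S \<rightarrow>\<^sub>M borel_on A. \<forall>s\<in>S. \<phi> s \<in> \<Gamma> s \<and> bellman f s = action_value f (s, \<phi> s)"
proof -
  obtain \<phi> where \<phi>: "\<phi> \<in> borel_on S \<rightarrow>\<^sub>M borel_on A" "\<And>s. s \<in> S \<Longrightarrow> \<phi> s \<in> \<Gamma> s"
      "\<And>s a. s \<in> S \<Longrightarrow> a \<in> \<Gamma> s \<Longrightarrow> action_value f (s, a) \<le> action_value f (s, \<phi> s)"
    using supermodular_maximizer_selection[OF usc_\<Gamma> feasible super_\<Gamma> action_value_props(1,3)[OF f]]
    by blast
  then have "bellman f s = action_value f (s, \<phi> s)" if "s \<in> S" for s
    unfolding bellman_def using that by (intro cSup_eq_maximum) auto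
  with \<phi> show ?thesis by blast
qed

lemma bellman_upper:
  assumes "admissible f" "s \<in> S" "a \<in> \<Gamma> s"
  shows "action_value f (s, a) \<le> bellman f s"
  unfolding bellman_def
proof (rule cSUP_upper[OF assms(3)])
  have "bdd_above (action_value f ` (S \<times> A))"
    using action_value_props(2)[OF assms(1)] by (rule bounded_imp_bdd_above)
  then show "bdd_above ((\<lambda>a. action_value f (s, a)) ` \<Gamma> s)"
    by (rule bdd_above_mono) (use assms(2) feasible in blast)
qed

lemma admissible_bellman:
  assumes f: "admissible f"
  shows "admissible (bellman f)"
proof -
  obtain \<phi> where \<phi>: "\<And>s. s \<in> S \<Longrightarrow> \<phi> s \<in> \<Gamma> s"
      "\<And>s. s \<in> S \<Longrightarrow> bellman f s = action_value f (s, \<phi> s)"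
    using bellman_selection[OF f] by blast
  have "usc_on S (bellman f)"
    unfolding usc_on_def
  proof
    fix c
    have "closedin (top_of_set S) {s \<in> S. \<exists>a\<in>\<Gamma> s. (s, a) \<in> {x \<in> S \<times> A. c \<le> action_value f x}}"
      using feasible usc_on_closedin_ge[OF action_value_props(1)[OF f]]
      by (intro closedin_usc_correspondence_image[OF usc_\<Gamma>]) auto
    then have "openin (top_of_set S)
        (S - {s \<in> S. \<exists>a\<in>\<Gamma> s. (s, a) \<in> {x \<in> S \<times> A. c \<le> action_value f x}})"
      by (simp add: closedin_def)
    \<comment> \<open>Because the supremum is attained, no feasible action reaching \<open>c\<close>
      means a value strictly below \<open>c\<close>.\<close>
    also have "S - {s \<in> S. \<exists>a\<in>\<Gamma> s. (s, a) \<in> {x \<in> S \<times> A. c \<le> action_value f x}} =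
        {s \<in> S. bellman f s < c}"
    proof (intro equalityI subsetI)
      fix s assume "s \<in> S - {s \<in> S. \<exists>a\<in>\<Gamma> s. (s, a) \<in> {x \<in> S \<times> A. c \<le> action_value f x}}"
      then show "s \<in> {s \<in> S. bellman f s < c}"
        using \<phi>[of s] feasible[of s] by force
    next
      fix s assume "s \<in> {s \<in> S. bellman f s < c}"
      then show "s \<in> S - {s \<in> S. \<exists>a\<in>\<Gamma> s. (s, a) \<in> {x \<in> S \<times> A. c \<le> action_value f x}}"
        using bellman_upper[OF f] by force
    qed
    finally show "openin (top_of_set S) {s \<in> S. bellman f s < c}" .
  qed
  moreover have "bounded (bellman f ` S)"
    \<comment> \<open>Every value of \<open>bellman f\<close> on \<open>S\<close> is a value of
      \<open>action_value f\<close> on \<open>S \<times> A\<close>.\<close>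
    by (rule bounded_subset[OF action_value_props(2)[OF f]]) (use \<phi> feasible in fastforce)
  moreover have "supermodular_on S (bellman f)"
    unfolding supermodular_on_def
  proof (intro ballI)
    fix s s' assume s: "s \<in> S" "s' \<in> S"
    have \<Gamma>: "sup (\<phi> s) (\<phi> s') \<in> \<Gamma> (sup s s')" "inf (\<phi> s) (\<phi> s') \<in> \<Gamma> (inf s s')"
      using super_\<Gamma> \<phi>(1) s unfolding supermodular_correspondence_def by blast+
    have "(s, \<phi> s) \<in> S \<times> A" "(s', \<phi> s') \<in> S \<times> A"
      using \<phi>(1) s feasible by auto
    then have "action_value f (s, \<phi> s) + action_value f (s', \<phi> s')
        \<le> action_value f (sup (s, \<phi> s) (s', \<phi> s')) + action_value f (inf (s, \<phi> s) (s', \<phi> s'))"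
      using action_value_props(3)[OF f] unfolding supermodular_on_def by blast
    \<comment> \<open>The joined and met actions are feasible but need not be optimal, hence only an
      inequality.\<close>
    also have "\<dots> \<le> bellman f (sup s s') + bellman f (inf s s')"
      using \<Gamma> s lattice_S by (auto intro!: add_mono bellman_upper[OF f] simp: is_lattice_def)
    finally show "bellman f s + bellman f s' \<le> bellman f (sup s s') + bellman f (inf s s')"
      using \<phi>(2) s by simp
  qed
  ultimately show ?thesis
    by (simp add: admissible_def)
qed

text \<open>\<open>n\<close> counts the periods that remain, so time \<open>t\<close> of an
  \<open>n\<close>-period problem calls for the index \<open>n - t\<close>.\<close>

definition finite_horizon_value :: "nat \<Rightarrow> 's \<Rightarrow> real" where
  "finite_horizon_value n = (bellman ^^ n) (\<lambda>_. 0)"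

lemma finite_horizon_value_0 [simp]: "finite_horizon_value 0 s = 0"
  by (simp add: finite_horizon_value_def)

lemma finite_horizon_value_Suc: "finite_horizon_value (Suc n) = bellman (finite_horizon_value n)"
  by (simp add: finite_horizon_value_def)

lemma admissible_finite_horizon_value: "admissible (finite_horizon_value n)"
proof (induction n)
  case 0
  have "openin (top_of_set S) {x \<in> S. (0::real) < c}" for c
    by (cases "0 < c") auto
  then show ?case
    by (auto simp: admissible_def usc_on_def supermodular_on_def finite_horizon_value_def bounded_iff)
qed (simp add: finite_horizon_value_Suc admissible_bellman)

text \<open>\<open>subsolution_le_truncated_value\<close> asks for one bound at all times; summing
  the bounds of the finitely many horizons provides it.\<close>

lemma finite_horizon_value_bound:
  obtains B where "\<And>m x. m \<le> n \<Longrightarrow> x \<in> S \<Longrightarrow> \<bar>finite_horizon_value m x\<bar> \<le> B"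
proof -
  have "\<exists>b. \<forall>x\<in>S. \<bar>finite_horizon_value m x\<bar> \<le> b" for m
    using admissible_finite_horizon_value[of m] by (auto simp: admissible_def bounded_iff)
  then obtain b where b: "\<And>m x. x \<in> S \<Longrightarrow> \<bar>finite_horizon_value m x\<bar> \<le> b m" by metis
  have "\<bar>finite_horizon_value m x\<bar> \<le> (\<Sum>m\<le>n. \<bar>b m\<bar>)" if "m \<le> n" "x \<in> S" for m x
    using b[OF that(2), of m] member_le_sum[of m "{..n}" "\<lambda>m. \<bar>b m\<bar>"] that(1) by simp
  then show ?thesis using that by blast
qed

section \<open>Strategy values against finite-horizon values\<close>

lemma strategy_process:
  assumes "\<sigma> \<in> strategies S A \<Gamma>" "s \<in> S"
  shows "controlled_process S A p \<sigma> s"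
  using assms p by (auto simp: strategies_def intro!: controlled_process.intro)

text \<open>No feasible action beats the maximum in \<open>bellman\<close>, so the finite-horizon
  values form a supersolution along any strategy. Negating them and \<open>r\<close> gives a
  subsolution.\<close>

lemma strategy_value_le:
  assumes strategy: "\<sigma> \<in> strategies S A \<Gamma>" and s: "s \<in> S"
    and K: "\<And>y. y \<in> S \<times> A \<Longrightarrow> \<bar>r y\<bar> \<le> K"
  shows "strategy_value S A p r \<beta> \<sigma> s \<le> finite_horizon_value n s + \<beta> ^ n * K / (1 - \<beta>)"
proof -
  let ?v = finite_horizon_value
  interpret controlled_process S A p \<sigma> s
    using strategy_process[OF strategy s] .
  obtain B where B: "\<And>m x. m \<le> n \<Longrightarrow> x \<in> S \<Longrightarrow> \<bar>?v m x\<bar> \<le> B"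
    using finite_horizon_value_bound[of n] by blast
  \<comment> \<open>Writing \<open>n - 0\<close> identifies \<open>w t\<close> as
    \<open>- ?v (n - t)\<close>, which vanishes at \<open>t = n\<close>.\<close>
  have "- ?v (n - 0) s \<le> (\<Sum>t<n. \<beta> ^ t * (\<integral>\<omega>. - r (\<omega> t) \<partial>law))"
  proof (rule subsolution_le_truncated_value[where K = K and B = B])
    show "(\<lambda>y. - r y) \<in> borel_measurable (borel_on (S \<times> A))"
      using borel_measurable_r by simp
    show "(\<lambda>x. - ?v (n - t) x) \<in> borel_measurable (borel_on S)" for t
      using admissible_finite_horizon_value[of "n - t"]
      by (auto simp: admissible_def intro!: borel_measurable_uminus borel_measurable_usc_on)
    show "\<bar>- r y\<bar> \<le> K" if "y \<in> S \<times> A" for y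
      using K[OF that] by simp
    show "\<bar>- ?v (n - t) x\<bar> \<le> B" if "x \<in> S" for t x
      using B[of "n - t" x] that by simp
    fix t h x assume t: "t < n" and hx: "h \<in> space (paths t)" "x \<in> S"
    then have "(h, x) \<in> space (histories S A t)"
      by (simp add: space_pair_measure space_restrict_space)
    then have "\<sigma> t (h, x) \<in> \<Gamma> x"
      using strategy by (fastforce simp: strategies_def)
    from bellman_upper[OF admissible_finite_horizon_value[of "n - Suc t"] hx(2) this]
    show "- ?v (n - t) x \<le> - r (x, \<sigma> t (h, x)) + \<beta> * (\<integral>x'. - ?v (n - Suc t) x' \<partial>p (x, \<sigma> t (h, x)))"
      using t by (simp add: action_value_def Suc_diff_Suc flip: finite_horizon_value_Suc)
  qed (use beta in simp_all)
  then show ?thesis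
    using strategy_value_truncation[OF borel_measurable_r K, of \<beta> n] beta
    by (simp add: sum_negf abs_le_iff)
qed

text \<open>Playing the maximiser for the remaining horizon turns the optimality equation into the
  subsolution condition, with equality.\<close>

lemma strategy_value_ge:
  assumes s: "s \<in> S" and K: "\<And>y. y \<in> S \<times> A \<Longrightarrow> \<bar>r y\<bar> \<le> K"
  shows "\<exists>\<sigma>\<in>strategies S A \<Gamma>.
    finite_horizon_value n s - \<beta> ^ n * K / (1 - \<beta>) \<le> strategy_value S A p r \<beta> \<sigma> s"
proof -
  let ?v = finite_horizon_value
  have "\<exists>\<phi>. \<phi> \<in> borel_on S \<rightarrow>\<^sub>M borel_on A \<and>
      (\<forall>s\<in>S. \<phi> s \<in> \<Gamma> s \<and> bellman (?v m) s = action_value (?v m) (s, \<phi> s))" for m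
    using bellman_selection[OF admissible_finite_horizon_value[of m]] by blast
  then obtain \<phi> where \<phi>: "\<And>m. \<phi> m \<in> borel_on S \<rightarrow>\<^sub>M borel_on A" "\<And>m s. s \<in> S \<Longrightarrow> \<phi> m s \<in> \<Gamma> s"
      "\<And>m s. s \<in> S \<Longrightarrow> bellman (?v m) s = action_value (?v m) (s, \<phi> m s)"
    by metis
  \<comment> \<open>After the action at time \<open>t\<close>, \<open>n - Suc t\<close> periods
    remain. From time \<open>n\<close> on, truncated subtraction gives the rule
    \<open>\<phi> 0\<close>, which is still feasible.\<close>
  define \<sigma> :: "('s, real ^ 'k) strategy" where "\<sigma> t y = \<phi> (n - Suc t) (snd y)" for t y
  have "\<sigma> t \<in> histories S A t \<rightarrow>\<^sub>M borel_on A" for t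
    unfolding \<sigma>_def[abs_def] by (rule measurable_compose[OF measurable_snd \<phi>(1)])
  then have strategy: "\<sigma> \<in> strategies S A \<Gamma>"
    using \<phi>(2) by (simp add: strategies_def \<sigma>_def space_pair_measure space_restrict_space)
  interpret controlled_process S A p \<sigma> s
    using strategy_process[OF strategy s] .
  obtain B where B: "\<And>m x. m \<le> n \<Longrightarrow> x \<in> S \<Longrightarrow> \<bar>?v m x\<bar> \<le> B"
    using finite_horizon_value_bound[of n] by blast
  have "?v (n - 0) s \<le> (\<Sum>t<n. \<beta> ^ t * (\<integral>\<omega>. r (\<omega> t) \<partial>law))"
  proof (rule subsolution_le_truncated_value[where K = K and B = B])
    show "?v (n - t) \<in> borel_measurable (borel_on S)" for t
      using admissible_finite_horizon_value[of "n - t"]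
      by (auto simp: admissible_def intro!: borel_measurable_usc_on)
    show "\<bar>?v (n - t) x\<bar> \<le> B" if "x \<in> S" for t x
      using B[of "n - t" x] that by simp
    fix t h x assume t: "t < n" and x: "x \<in> S"
    have "?v (n - t) x = bellman (?v (n - Suc t)) x"
      using t by (simp add: Suc_diff_Suc flip: finite_horizon_value_Suc)
    then show "?v (n - t) x \<le> r (x, \<sigma> t (h, x)) + \<beta> * (\<integral>x'. ?v (n - Suc t) x' \<partial>p (x, \<sigma> t (h, x)))"
      using \<phi>(3)[OF x] by (simp add: action_value_def \<sigma>_def)
  qed (use beta K borel_measurable_r in simp_all)
  then have "?v n s - \<beta> ^ n * K / (1 - \<beta>) \<le> strategy_value S A p r \<beta> \<sigma> s"
    using strategy_value_truncation[OF borel_measurable_r K, of \<beta> n] beta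
    by (simp add: abs_le_iff)
  with strategy show ?thesis by blast
qed

lemma finite_horizon_value_tendsto:
  assumes s: "s \<in> S"
  shows "(\<lambda>n. finite_horizon_value n s) \<longlonglongrightarrow> value_function S A \<Gamma> p r \<beta> s"
proof -
  let ?V = "value_function S A \<Gamma> p r \<beta> s"
  obtain K where K: "\<And>y. y \<in> S \<times> A \<Longrightarrow> \<bar>r y\<bar> \<le> K"
    using bounded_r by (auto simp: bounded_iff)
  have upper: "?V \<le> finite_horizon_value n s + \<beta> ^ n * K / (1 - \<beta>)" for n
    unfolding value_function_def
  proof (rule cSUP_least)
    \<comment> \<open>The strategy built for the lower bound also shows that strategies
      exist.\<close>
    show "strategies S A \<Gamma> \<noteq> {}"
      using strategy_value_ge[OF s K] by blast
  qed (rule strategy_value_le[OF _ s K])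
  have lower: "finite_horizon_value n s - \<beta> ^ n * K / (1 - \<beta>) \<le> ?V" for n
  proof -
    obtain \<sigma> where \<sigma>: "\<sigma> \<in> strategies S A \<Gamma>"
        "finite_horizon_value n s - \<beta> ^ n * K / (1 - \<beta>) \<le> strategy_value S A p r \<beta> \<sigma> s"
      using strategy_value_ge[OF s K] by blast
    \<comment> \<open>A real supremum dominates its members only if the set is bounded above; the
      upper estimate at horizon \<open>n\<close> bounds it.\<close>
    have "bdd_above ((\<lambda>\<sigma>. strategy_value S A p r \<beta> \<sigma> s) ` strategies S A \<Gamma>)"
      by (rule bdd_aboveI2) (rule strategy_value_le[OF _ s K])
    then show ?thesis
      unfolding value_function_def using \<sigma>
      by (rule cSUP_upper2[where f = "\<lambda>\<sigma>. strategy_value S A p r \<beta> \<sigma> s"])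
  qed
  have "(\<lambda>n. \<beta> ^ n * K / (1 - \<beta>)) \<longlonglongrightarrow> 0 * K / (1 - \<beta>)"
    using beta by (intro tendsto_intros LIMSEQ_realpow_zero) simp_all
  then have lim: "(\<lambda>n. \<beta> ^ n * K / (1 - \<beta>)) \<longlonglongrightarrow> 0"
    by simp
  have "norm (finite_horizon_value n s - ?V) \<le> \<beta> ^ n * K / (1 - \<beta>)" for n
    using lower[of n] upper[of n] unfolding real_norm_def abs_le_iff by linarith
  from Lim_null_comparison[OF always_eventually[OF allI[OF this]] lim] show ?thesis
    by (rule LIM_zero_cancel)
qed

end

section \<open>Supermodularity in the limit of infinite horizon\<close>

theorem theorem3p3:
  fixes S :: "(real ^ 'n) set" and A :: "(real ^ 'k) set"
    and \<Gamma> :: "real ^ 'n \<Rightarrow> (real ^ 'k) set"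
    and p :: "(real ^ 'n) \<times> (real ^ 'k) \<Rightarrow> (real ^ 'n) measure"
    and r :: "(real ^ 'n) \<times> (real ^ 'k) \<Rightarrow> real"
    and \<beta> :: real
  assumes "S \<in> sets borel" and "completely_metrizable_space (top_of_set S)"
    and "A \<in> sets borel"
    and "0 < \<beta>" and "\<beta> < 1"
    and "p \<in> borel_on (S \<times> A) \<rightarrow>\<^sub>M prob_algebra (borel_on S)"
    and "usc_kernel S A p"
    and "r \<in> borel_measurable (borel_on (S \<times> A))"
    and "bounded (r ` (S \<times> A))" and "usc_on (S \<times> A) r"
    and "\<And>s. s \<in> S \<Longrightarrow> \<Gamma> s \<subseteq> A \<and> \<Gamma> s \<noteq> {} \<and> compact (\<Gamma> s)"
    and "usc_correspondence S A \<Gamma>"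
    and "is_lattice S" and "is_lattice A"
    and "supermodular_on (S \<times> A) r"
    and "supermodular_kernel S A p"
    and "supermodular_correspondence S \<Gamma>"
  shows "supermodular_on S (value_function S A \<Gamma> p r \<beta>)"
proof -
  interpret supermodular_decision_process S A \<Gamma> p r \<beta>
    using assms by unfold_locales
  show ?thesis
    unfolding supermodular_on_def
  proof (intro ballI)
    fix s s' assume s: "s \<in> S" "s' \<in> S"
    then have s_lattice: "sup s s' \<in> S" "inf s s' \<in> S"
      using \<open>is_lattice S\<close> by (auto simp: is_lattice_def)
    \<comment> \<open>The inequality holds at every horizon, and all four terms converge because the
      join and meet of the states lie in \<open>S\<close>.\<close>
    have "finite_horizon_value n s + finite_horizon_value n s'
        \<le> finite_horizon_value n (sup s s') + finite_horizon_value n (inf s s')" for n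
      using admissible_finite_horizon_value[of n] s
      unfolding admissible_def supermodular_on_def by blast
    then show "value_function S A \<Gamma> p r \<beta> s + value_function S A \<Gamma> p r \<beta> s'
        \<le> value_function S A \<Gamma> p r \<beta> (sup s s') + value_function S A \<Gamma> p r \<beta> (inf s s')"
      by (intro LIMSEQ_le[OF tendsto_add[OF s[THEN finite_horizon_value_tendsto]]
            tendsto_add[OF s_lattice[THEN finite_horizon_value_tendsto]]] exI allI impI)
  qed
qed

end
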